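(* Let $T$ be an $n$-vertex rooted tree and $\lambda$ an eigenvalue of $L(T)$. Then $$\lambda^2\le\frac{n-1}{n}H(T).$$
   Context: A rooted tree is a finite tree with a distinguished vertex (the root). The level $l(v)$ of a vertex $v$ is its distance from the root. For a rooted tree $T$ with vertices $v_1,\dots,v_n$, the level matrix $L(T)=(l_{ij})$ is the $n\times n$ real symmetric matrix with $l_{ij}=|l(v_i)-l(v_j)|$. Set $H(T)=\sum_{i=1}^n\sum_{j=1}^n l_{ij}^2=2\sum_{1\le i<j\le n}l_{ij}^2$. *)

theory Defs
  imports Graph_Theory.Graph_Theory Jordan_Normal_Form.Char_Poly
begin

text \<open>
  A \<^const>\<open>pair_graph\<close> is a finite simple graph in which every edge is represented by its two
  orientations. Going back and forth along one edge is therefore a directed cycle of length 2,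
  so the library predicate \<^const>\<open>tree\<close>, which excludes every directed cycle, is not the
  undirected notion. The cycles of the undirected graph are the directed cycles of length at
  least 3.
\<close>

definition undirected_tree :: "'a pair_pre_digraph \<Rightarrow> bool" where
  "undirected_tree T \<longleftrightarrow>
     pair_graph T \<and>
     Digraph_Component.connected (with_proj T) \<and>
     \<not> (\<exists>p. pre_digraph.cycle (with_proj T) p \<and> length p \<ge> 3)"

definition rooted_tree :: "'a pair_pre_digraph \<Rightarrow> 'a \<Rightarrow> bool" where
  "rooted_tree T r \<longleftrightarrow> undirected_tree T \<and> r \<in> pverts T"

text \<open>
  The library distance is extended-real valued (infinite between different components, which
  does not happen in a tree); with unit weights it is the number of edges of a shortest walk,
  see \<open>level_eq_Least\<close> below.
\<close>

definition level :: "'a pair_pre_digraph \<Rightarrow> 'a \<Rightarrow> 'a \<Rightarrow> real" where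
  "level T r v = real_of_ereal (wf_digraph.\<mu> (with_proj T) (\<lambda>_. 1) r v)"

text \<open>The list \<open>vs\<close> is the enumeration $v_1,\dots,v_n$ of the vertices, indexed from 0.\<close>

definition level_matrix :: "'a pair_pre_digraph \<Rightarrow> 'a \<Rightarrow> 'a list \<Rightarrow> real mat" where
  "level_matrix T r vs =
     mat (length vs) (length vs) (\<lambda>(i, j). \<bar>level T r (vs ! i) - level T r (vs ! j)\<bar>)"

definition H_index :: "'a pair_pre_digraph \<Rightarrow> 'a \<Rightarrow> 'a list \<Rightarrow> real" where
  "H_index T r vs =
     (\<Sum>i<length vs. \<Sum>j<length vs. (level_matrix T r vs $$ (i, j))\<^sup>2)"

lemma level_eq_Least:
  assumes "rooted_tree T r" "v \<in> pverts T"
  shows "level T r v =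
    real (LEAST k. \<exists>p. pre_digraph.awalk (with_proj T) r p v \<and> length p = k)"
proof -
  interpret pair_graph T
    using assms by (auto simp: rooted_tree_def undirected_tree_def)
  have cost: "awalk_cost (\<lambda>_. 1) p = real (length p)" for p
    by (induction p) auto
  have conn: "strongly_connected (with_proj (mk_symmetric (with_proj T)))"
    using assms by (auto simp: rooted_tree_def undirected_tree_def connected_def)
  have "parcs (mk_symmetric (with_proj T)) = parcs T"
    using pair_sym_arcs by (force simp: mk_symmetric_def symmetric_def sym_def)
  then have "mk_symmetric (with_proj T) = T"
    by (simp add: mk_symmetric_def)
  with conn assms have reach: "r \<rightarrow>\<^sup>*\<^bsub>with_proj T\<^esub> v"
    by (auto simp: strongly_connected_def rooted_tree_def)
  then obtain p where p: "apath r p v" "\<mu> (\<lambda>_. 1) r v = awalk_cost (\<lambda>_. 1) p"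
    using min_cost_awalk[of r v "\<lambda>_. 1"] by auto
  have min: "length p \<le> length q" if "awalk r q v" for q
    using min_cost_le_walk_cost[OF that, of "\<lambda>_. 1"] p(2) by (simp add: cost)
  have "(LEAST k. \<exists>p. awalk r p v \<and> length p = k) = length p"
    using p(1) min by (intro Least_equality) (auto simp: apath_def)
  then show ?thesis
    using p(2) by (simp add: level_def cost)
qed

end

theory Submission
  imports Defs "HOL-Analysis.Convex"
begin

text \<open>
  For a symmetric matrix \<open>A\<close> of trace 0 whose squared entries sum to
  \<open>H\<close>, the bound is usually read off the spectrum: the other \<open>n - 1\<close>
  eigenvalues sum to $-\lambda$ and their squares sum to $H - \lambda^2$, so Cauchy--Schwarz gives
  $\lambda^2 \le (n-1)(H - \lambda^2)$. The proof below reaches the same inequality without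
  diagonalizing. For an eigenvector $x$ of \<open>A\<close> with $s = x \cdot x$, let $M = x x^T -
  (s/n) I$, which is the multiple $s$ of the orthogonal projection onto the line of $x$ with its
  trace removed. In the Frobenius inner product, where the squared norm is the sum of the squared
  entries, $\langle A, M\rangle = x^T A x - (s/n)\,\mathrm{tr}\, A = \lambda s$ because the trace
  of $A$ vanishes, and $\|M\|^2 = s^2 (n-1)/n$. Cauchy--Schwarz for $A$ and $M$ is the claim,
  which is lemma \<open>eigenvalue_square_le_of_trace_zero\<close>. It applies to the level matrix
  because the diagonal of that matrix is 0.
\<close>

text \<open>
  Removing the trace is what improves the trivial constant 1 to $(n-1)/n$: among all $M$ that differ
  from $x x^T$ by a multiple of the identity, the traceless one has the least norm.
\<close>

lemma frobenius_norm_traceless_rank_one: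
  fixes x :: "nat \<Rightarrow> real" and n :: nat
  assumes "n > 0"
  defines "s \<equiv> (\<Sum>i<n. (x i)\<^sup>2)"
  shows "(\<Sum>i<n. \<Sum>j<n. (x i * x j - (if i = j then s / real n else 0))\<^sup>2)
    = s\<^sup>2 * ((real n - 1) / real n)"
proof -
  have entry: "(x i * x j - (if i = j then s / real n else 0))\<^sup>2 = (x i)\<^sup>2 * (x j)\<^sup>2
      + (if i = j then (s / real n)\<^sup>2 - 2 * (s / real n) * (x i)\<^sup>2 else 0)" for i j
    by (simp add: power2_eq_square algebra_simps)
  have "(\<Sum>i<n. \<Sum>j<n. (x i * x j - (if i = j then s / real n else 0))\<^sup>2)
      = (\<Sum>i<n. \<Sum>j<n. (x i)\<^sup>2 * (x j)\<^sup>2)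
        + (\<Sum>i<n. (s / real n)\<^sup>2 - 2 * (s / real n) * (x i)\<^sup>2)"
    by (simp add: entry sum.distrib)
  also have "\<dots> = s\<^sup>2 + (real n * (s / real n)\<^sup>2 - 2 * (s / real n) * s)"
    by (simp add: power2_eq_square[of s] sum_subtractf sum_distrib_left[symmetric]
        sum_distrib_right[symmetric] sum_divide_distrib[symmetric] s_def[symmetric])
  also have "\<dots> = s\<^sup>2 * ((real n - 1) / real n)"
    using \<open>n > 0\<close> by (simp add: field_simps power2_eq_square)
  finally show ?thesis .
qed

lemma eigenvalue_square_le_of_trace_zero:
  fixes A :: "real mat" and l :: real
  assumes A: "A \<in> carrier_mat n n"
    and trace: "(\<Sum>i<n. A $$ (i, i)) = 0"
    and eig: "eigenvalue A l"
  shows "l\<^sup>2 \<le> (real n - 1) / real n * (\<Sum>i<n. \<Sum>j<n. (A $$ (i, j))\<^sup>2)"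
proof -
  obtain v where v: "v \<in> carrier_vec n" "v \<noteq> 0\<^sub>v n" "A *\<^sub>v v = l \<cdot>\<^sub>v v"
    using eig A by (auto simp: eigenvalue_def eigenvector_def)
  define x where "x i = v $ i" for i
  define s where "s = (\<Sum>i<n. (x i)\<^sup>2)"
  define m where "m i j = x i * x j - (if i = j then s / real n else 0)" for i j
  obtain k where k: "k < n" "x k \<noteq> 0"
    using v(1,2) unfolding x_def by (metis carrier_vecD eq_vecI index_zero_vec(1,2))
  then have "n > 0" by simp
  have "s > 0"
    unfolding s_def using k by (intro sum_pos2[of _ k]) auto
  have row: "(\<Sum>j<n. A $$ (i, j) * x j) = l * x i" if "i < n" for i
  proof -
    have "(A *\<^sub>v v) $ i = (\<Sum>j<n. A $$ (i, j) * x j)"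
      using A v(1) that by (simp add: scalar_prod_def x_def lessThan_atLeast0)
    then show ?thesis
      using v(1,3) that by (simp add: x_def)
  qed
  have "(\<Sum>i<n. \<Sum>j<n. A $$ (i, j) * m i j)
      = (\<Sum>i<n. x i * (\<Sum>j<n. A $$ (i, j) * x j)) - s / real n * (\<Sum>i<n. A $$ (i, i))"
    by (simp add: m_def right_diff_distrib sum_subtractf sum_distrib_left mult_ac
        if_distrib[of "\<lambda>t. _ * t"] cong: if_cong)
  also have "\<dots> = l * s"
    using row trace by (simp add: s_def sum_distrib_left power2_eq_square mult_ac)
  finally have inner: "(\<Sum>i<n. \<Sum>j<n. A $$ (i, j) * m i j) = l * s" .
  have norm: "(\<Sum>i<n. \<Sum>j<n. (m i j)\<^sup>2) = s\<^sup>2 * ((real n - 1) / real n)"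
    unfolding m_def s_def by (rule frobenius_norm_traceless_rank_one[OF \<open>n > 0\<close>])
  have "(\<Sum>i<n. \<Sum>j<n. A $$ (i, j) * m i j)\<^sup>2
      \<le> (\<Sum>i<n. \<Sum>j<n. (A $$ (i, j))\<^sup>2) * (\<Sum>i<n. \<Sum>j<n. (m i j)\<^sup>2)"
    using Cauchy_Schwarz_ineq_sum[of "\<lambda>(i, j). A $$ (i, j)" "\<lambda>(i, j). m i j" "{..<n} \<times> {..<n}"]
    by (simp add: sum.cartesian_product case_prod_beta)
  then have "s\<^sup>2 * l\<^sup>2
      \<le> s\<^sup>2 * ((real n - 1) / real n * (\<Sum>i<n. \<Sum>j<n. (A $$ (i, j))\<^sup>2))"
    by (simp only: inner norm power_mult_distrib) (simp only: mult_ac)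
  then show ?thesis
    using \<open>s > 0\<close> by (simp only: mult_le_cancel_left_pos zero_less_power)
qed

theorem theorem8:
  fixes T :: "'a pair_pre_digraph" and r :: 'a and vs :: "'a list" and n :: nat and l :: real
  assumes "rooted_tree T r"
    and "card (pverts T) = n"
    and "distinct vs" and "set vs = pverts T"
    and "eigenvalue (level_matrix T r vs) l"
  shows "l\<^sup>2 \<le> (real n - 1) / real n * H_index T r vs"
proof -
  have n: "length vs = n"
    using assms(2-4) distinct_card by metis
  have "level_matrix T r vs \<in> carrier_mat n n"
    and "(\<Sum>i<n. level_matrix T r vs $$ (i, i)) = 0"
    by (simp_all add: level_matrix_def n)
  from eigenvalue_square_le_of_trace_zero[OF this assms(5)] show ?thesis
    by (simp add: H_index_def n)
qed

end
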